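(* Let $q$ be a prime power. For integers $0<\rho<n\le m$, $K_R(q^m,n,\rho)\ge 3$.
   Context: For $\mathbf{x}\in \mathrm{GF}(q^m)^n$, $\mathrm{rk}(\mathbf{x})$ is the maximum number of coordinates of $\mathbf{x}$ that are linearly independent over $\mathrm{GF}(q)$; the rank distance is $d_R(\mathbf{x},\mathbf{y})=\mathrm{rk}(\mathbf{x}-\mathbf{y})$. The rank covering radius of a nonempty code $C\subseteq \mathrm{GF}(q^m)^n$ is $\max_{\mathbf{x}\in \mathrm{GF}(q^m)^n}\min_{\mathbf{c}\in C} d_R(\mathbf{x},\mathbf{c})$. $K_R(q^m,n,\rho)$ denotes the minimum number of balls of rank radius $\rho$ needed to cover $\mathrm{GF}(q^m)^n$, i.e. the minimum cardinality of a (not necessarily linear) code $C\subseteq\mathrm{GF}(q^m)^n$ with rank covering radius at most $\rho$. *)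

theory Defs
  imports "HOL-Algebra.Algebra" "HOL-Number_Theory.Prime_Powers"
begin

(* F is the field GF(q^m), K is its subfield GF(q); a vector of GF(q^m)^n is a list of length n. *)

definition vectors :: "('a, 'b) ring_scheme \<Rightarrow> nat \<Rightarrow> 'a list set" where
  "vectors F n = {x. set x \<subseteq> carrier F \<and> length x = n}"

(* The maximum is taken over sets I of positions, and independence of the list nths x I is
   independence of the family (x_i) for i in I: a value repeated at two positions of I makes it
   dependent. I = {} always qualifies. *)
definition rank_weight :: "('a, 'b) ring_scheme \<Rightarrow> 'a set \<Rightarrow> 'a list \<Rightarrow> nat" where
  "rank_weight F K x =
     Max {card I | I. I \<subseteq> {..<length x} \<and> ring.independent F K (nths x I)}"

definition rank_dist :: "('a, 'b) ring_scheme \<Rightarrow> 'a set \<Rightarrow> 'a list \<Rightarrow> 'a list \<Rightarrow> nat" where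
  "rank_dist F K x y = rank_weight F K (map2 (\<lambda>a b. a \<ominus>\<^bsub>F\<^esub> b) x y)"

(* Meaningful for nonempty C only (Min of the empty set is unspecified). *)
definition rank_covering_radius ::
    "('a, 'b) ring_scheme \<Rightarrow> 'a set \<Rightarrow> nat \<Rightarrow> 'a list set \<Rightarrow> nat" where
  "rank_covering_radius F K n C =
     Max ((\<lambda>x. Min ((\<lambda>c. rank_dist F K x c) ` C)) ` vectors F n)"

(* For finite F the minimum ranges over a finite set, which is nonempty because C = vectors F n,
   of covering radius 0, is always admissible. *)
definition rank_covering_number ::
    "('a, 'b) ring_scheme \<Rightarrow> 'a set \<Rightarrow> nat \<Rightarrow> nat \<Rightarrow> nat" where
  "rank_covering_number F K n \<rho> =
     Min {card C | C. C \<subseteq> vectors F n \<and> C \<noteq> {} \<and> rank_covering_radius F K n C \<le> \<rho>}"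

end

(* Two codewords never suffice, because some vector has full rank distance n to both. After a
   translation this asks, for a given d, for a vector y such that y and y + d are both of full rank.
   If the coordinates of d are independent, take y = w d with w different from 0 and -1. Otherwise
   some coordinate of d lies in the span U of the others, and y is built greedily with that
   coordinate chosen last. At each step the new entry must avoid two proper subspaces, one of them
   translated by the current coordinate of d; a translation by an element of their sum can be
   absorbed, and a vector space is not the union of two proper subspaces. Before the last step the
   first subspace has room to be enlarged by the current coordinate of d; at the last step U is
   contained in the sum of the two subspaces. *)

theory Submission
  imports Defs
begin

section \<open>Additive subgroups, and spans over a subfield\<close>

context ring
begin

lemma add_mem_subgroup_iff:
  assumes U: "subgroup U (add_monoid R)" and x: "x \<in> carrier R" and u: "u \<in> U"
  shows "x \<oplus> u \<in> U \<longleftrightarrow> x \<in> U"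
proof
  have "u \<in> carrier R"
    using subgroup.mem_carrier[OF U u] by simp
  then have "x \<oplus> u \<oplus> \<ominus> u = x"
    using x by algebra
  moreover have "\<ominus> u \<in> U"
    using subgroup.m_inv_closed[OF U u] by (simp add: a_inv_def)
  ultimately show "x \<oplus> u \<in> U \<Longrightarrow> x \<in> U"
    using subgroup.m_closed[OF U, of "x \<oplus> u" "\<ominus> u"] by simp
next
  show "x \<in> U \<Longrightarrow> x \<oplus> u \<in> U"
    using subgroup.m_closed[OF U] u by simp
qed

text \<open>Take \<open>a\<close> outside \<open>U\<close> and \<open>b\<close> outside
  \<open>V\<close>. Either one of them avoids both subgroups, or \<open>a\<close> is in
  \<open>V\<close> and \<open>b\<close> in \<open>U\<close>, and then \<open>a \<oplus> b\<close>
  avoids both.\<close>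

lemma additive_subgroups_not_cover:
  assumes U: "subgroup U (add_monoid R)" and V: "subgroup V (add_monoid R)"
    and "U \<noteq> carrier R" and "V \<noteq> carrier R"
  obtains y where "y \<in> carrier R" and "y \<notin> U" and "y \<notin> V"
proof -
  have sub: "U \<subseteq> carrier R" "V \<subseteq> carrier R"
    using U V subgroup.subset by fastforce+
  obtain a b where a: "a \<in> carrier R" "a \<notin> U" and b: "b \<in> carrier R" "b \<notin> V"
    using assms sub by blast
  show thesis
  proof (cases "a \<in> V \<and> b \<in> U")
    case True
    have "a \<oplus> b \<notin> U"
      using a True add_mem_subgroup_iff[OF U] by blast
    moreover have "a \<oplus> b \<notin> V"
      using a(1) b True add_mem_subgroup_iff[OF V] by (metis a_comm)
    ultimately show thesis
      using that a b by blast
  next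
    case False
    then show thesis
      using that a b by blast
  qed
qed

text \<open>Put \<open>z = y \<oplus> u\<close>. Modulo \<open>U\<close> the shift by
  \<open>u\<close> is invisible, and modulo \<open>V\<close> the shift by \<open>v\<close> is, so
  both conditions reduce to \<open>z\<close> lying outside \<open>U\<close> and
  \<open>V\<close>.\<close>

lemma additive_subgroups_not_cover_translate:
  assumes U: "subgroup U (add_monoid R)" and V: "subgroup V (add_monoid R)"
    and "U \<noteq> carrier R" and "V \<noteq> carrier R"
    and u: "u \<in> U" and v: "v \<in> V"
  obtains y where "y \<in> carrier R" and "y \<notin> U" and "y \<oplus> (u \<oplus> v) \<notin> V"
proof -
  obtain z where z: "z \<in> carrier R" "z \<notin> U" "z \<notin> V"
    using additive_subgroups_not_cover assms by blast
  have carr: "u \<in> carrier R" "v \<in> carrier R"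
    using u v U V subgroup.subset by fastforce+
  have "z \<ominus> u \<oplus> u = z"
    using z carr by algebra
  then have "z \<ominus> u \<notin> U"
    using add_mem_subgroup_iff[OF U _ u, of "z \<ominus> u"] z carr by simp
  moreover have "(z \<ominus> u) \<oplus> (u \<oplus> v) = z \<oplus> v"
    using z carr by algebra
  moreover have "z \<oplus> v \<notin> V"
    using add_mem_subgroup_iff[OF V _ v] z by blast
  ultimately show thesis
    using that[of "z \<ominus> u"] z carr by simp
qed

text \<open>Either the head lies in the span of the tail, or the tail is already dependent and
  adjoining the head only enlarges the span. The split form keeps the position of \<open>b\<close>,
  where a new entry is inserted later.\<close>

lemma dependent_imp_mem_Span_others:
  assumes "subfield K R" and "set xs \<subseteq> carrier R" and "dependent K xs"
  obtains as b bs where "xs = as @ b # bs" and "b \<in> Span K (as @ bs)"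
proof -
  have "\<exists>as b bs. xs = as @ b # bs \<and> b \<in> Span K (as @ bs)"
    using assms(2,3)
  proof (induction xs)
    case Nil
    then show ?case by simp
  next
    case (Cons x xs)
    show ?case
    proof (cases "x \<in> Span K xs")
      case True
      then show ?thesis by (metis append_Nil)
    next
      case False
      then have "dependent K xs"
        using Cons.prems li_Cons by auto
      then obtain as b bs where *: "xs = as @ b # bs" "b \<in> Span K (as @ bs)"
        using Cons by auto
      then have "b \<in> Span K (x # as @ bs)"
        using mono_Span[OF assms(1), of "as @ bs" x] Cons.prems by auto
      then show ?thesis
        using *(1) by (metis append_Cons)
    qed
  qed
  then show thesis using that by blast
qed

text \<open>Coefficient lists of the length of \<open>Us\<close> map onto the span. This count is
  what later shows that fewer than \<open>m\<close> elements cannot span the field.\<close>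

lemma card_Span_le:
  assumes "subfield K R" and "set Us \<subseteq> carrier R" and "finite K"
  shows "card (Span K Us) \<le> card K ^ length Us"
proof -
  have "Span K Us = (\<lambda>Ks. combine Ks Us) ` {Ks. set Ks \<subseteq> K \<and> length Ks = length Us}"
    unfolding Span_eq_combine_set_length_version[OF assms(1,2)] by blast
  then show ?thesis
    using card_image_le[OF finite_lists_length_eq[OF assms(3)]] card_lists_length_eq[OF assms(3)]
    by metis
qed

end

section \<open>Pairs of independent lists with prescribed difference\<close>

text \<open>A relation among the multiples is \<open>a\<close> times the same relation among the
  original elements, and \<open>a\<close> can be cancelled.\<close>

lemma (in field) independent_map_mult:
  assumes K: "subfield K R" and ind: "independent K Us"
    and a: "a \<in> carrier R" "a \<noteq> \<zero>"
  shows "independent K (map (\<lambda>u. u \<otimes> a) Us)"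
proof (rule trivial_combine_imp_independent[OF K])
  have Us: "set Us \<subseteq> carrier R"
    using independent_in_carrier ind .
  then show "set (map (\<lambda>u. u \<otimes> a) Us) \<subseteq> carrier R"
    using a by auto
  fix Ks assume Ks: "set Ks \<subseteq> K" and 0: "combine Ks (map (\<lambda>u. u \<otimes> a) Us) = \<zero>"
  then have Ks': "set Ks \<subseteq> carrier R"
    using subringE(1)[OF subfieldE(1)[OF K]] by blast
  then have "combine Ks Us \<otimes> a = \<zero>"
    using 0 combine_l_distr[OF Ks' Us a(1)] by simp
  then have "combine Ks Us = \<zero>"
    using a Ks' Us integral by blast
  then show "set (take (length (map (\<lambda>u. u \<otimes> a) Us)) Ks) \<subseteq> {\<zero>}"
    using independent_imp_trivial_combine[OF K ind Ks] by simp
qed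

text \<open>Induction on \<open>ds\<close>: the new entry \<open>y\<close> must avoid the span of
  \<open>ys\<close>, and \<open>y \<oplus> d\<close> the span of the sums. The hypothesis
  \<open>proper\<close> expresses that the dimension is at least \<open>m\<close>.\<close>

lemma (in ring) exists_independent_pair:
  assumes K: "subfield K R"
    and proper: "\<And>Us. set Us \<subseteq> carrier R \<Longrightarrow> length Us < m \<Longrightarrow> Span K Us \<noteq> carrier R"
    and "set ds \<subseteq> carrier R" and "length ds < m"
  shows "\<exists>ys. length ys = length ds \<and> independent K ys \<and> independent K (map2 (\<oplus>) ys ds)"
  using assms(3,4)
proof (induction ds)
  case Nil
  then show ?case by simp
next
  case (Cons d ds)
  then obtain ys where ys: "length ys = length ds" "independent K ys" "independent K (map2 (\<oplus>) ys ds)"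
    by auto
  let ?zs = "map2 (\<oplus>) ys ds"
  have carr: "set (d # ys) \<subseteq> carrier R" "set ys \<subseteq> carrier R" "set ?zs \<subseteq> carrier R" "d \<in> carrier R"
    using ys(2,3)[THEN independent_in_carrier] Cons.prems by simp_all
  \<comment> \<open>\<open>d # ys\<close> is as long as the list being treated, hence still shorter
    than \<open>m\<close>: adjoining \<open>d\<close> keeps the span proper.\<close>
  have "Span K (d # ys) \<noteq> carrier R" "Span K ?zs \<noteq> carrier R"
    using proper[of "d # ys"] proper[of ?zs] carr ys(1) Cons.prems by (auto simp del: Span.simps)
  \<comment> \<open>The translation \<open>d\<close> is split as \<open>d\<close> plus zero, one
    summand in each of the two spans.\<close>
  moreover have "d \<in> Span K (d # ys)"
    using Span_base_incl[OF K carr(1)] by simp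
  moreover have "\<zero> \<in> Span K ?zs"
    using Span_subgroup_props(2)[OF K carr(3)] .
  ultimately obtain y where y: "y \<in> carrier R" "y \<notin> Span K (d # ys)" "y \<oplus> (d \<oplus> \<zero>) \<notin> Span K ?zs"
    using additive_subgroups_not_cover_translate
      Span_is_add_subgroup[OF K carr(1)] Span_is_add_subgroup[OF K carr(3)] by blast
  then have "y \<notin> Span K ys"
    using mono_Span[OF K carr(2,4)] by blast
  then have "independent K (y # ys)" "independent K ((y \<oplus> d) # ?zs)"
    using ys y carr by (auto intro!: li_Cons simp del: Span.simps)
  then show ?case
    using ys(1) by (intro exI[of _ "y # ys"]) simp
qed

text \<open>When \<open>length ds = m\<close>, the last step has no room for adjoining the entry of
  \<open>ds\<close>, so it is reserved for an entry in the span of the others. If there is none,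
  \<open>ds\<close> is independent and scaling by \<open>w\<close> works.\<close>

lemma (in field) exists_independent_pair_le:
  assumes K: "subfield K R"
    and proper: "\<And>Us. set Us \<subseteq> carrier R \<Longrightarrow> length Us < m \<Longrightarrow> Span K Us \<noteq> carrier R"
    and ds: "set ds \<subseteq> carrier R" and len: "length ds \<le> m"
    and w: "w \<in> carrier R" "w \<noteq> \<zero>" "w \<oplus> \<one> \<noteq> \<zero>"
  shows "\<exists>ys. length ys = length ds \<and> independent K ys \<and> independent K (map2 (\<oplus>) ys ds)"
proof (cases "independent K ds")
  case True
  \<comment> \<open>Both \<open>w\<close> and \<open>w \<oplus> \<one>\<close> are nonzero, so both
    lists are nonzero multiples of the independent list \<open>ds\<close>.\<close>
  have "map2 (\<oplus>) (map (\<lambda>u. u \<otimes> w) ds) ds = map (\<lambda>u. u \<otimes> (w \<oplus> \<one>)) ds"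
    using ds w by (induction ds) (auto simp: r_distr)
  then show ?thesis
    using independent_map_mult[OF K True] w
    by (intro exI[of _ "map (\<lambda>u. u \<otimes> w) ds"]) simp
next
  case False
  then obtain as b bs where ds_eq: "ds = as @ b # bs" and b: "b \<in> Span K (as @ bs)"
    using dependent_imp_mem_Span_others[OF K ds] by metis
  have carr: "set (as @ bs) \<subseteq> carrier R" "b \<in> carrier R"
    using ds ds_eq by auto
  have "length (as @ bs) < m"
    using len ds_eq by simp
  then obtain ys where ys: "length ys = length (as @ bs)" "independent K ys"
      "independent K (map2 (\<oplus>) ys (as @ bs))"
    using exists_independent_pair[OF K _ carr(1)] proper by blast
  let ?zs = "map2 (\<oplus>) ys (as @ bs)"
  have carr': "set ys \<subseteq> carrier R" "set ?zs \<subseteq> carrier R"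
    using ys(2,3) independent_in_carrier by blast+
  have proper': "Span K ys \<noteq> carrier R" "Span K ?zs \<noteq> carrier R"
    using proper[of ys] proper[of ?zs] carr' ys(1) len ds_eq by (auto simp del: Span.simps)
  \<comment> \<open>Each entry of \<open>as @ bs\<close> is the difference of an entry of
    \<open>?zs\<close> and one of \<open>ys\<close>. Hence \<open>b\<close> lies in the sum of the
    two spans, as the translated covering argument requires.\<close>
  have "set (as @ bs) \<subseteq> Span K (ys @ ?zs)"
  proof
    fix x assume "x \<in> set (as @ bs)"
    then obtain i where i: "i < length (as @ bs)" "x = (as @ bs) ! i"
      by (metis in_set_conv_nth)
    have mem: "ys ! i \<in> set ys" "?zs ! i \<in> set ?zs"
      using i(1) ys(1) by (intro nth_mem, simp)+
    have eq: "?zs ! i = ys ! i \<oplus> x"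
      using i ys(1) by simp
    have c: "ys ! i \<in> carrier R" "x \<in> carrier R"
      using mem(1) carr'(1) carr(1) \<open>x \<in> set (as @ bs)\<close> by blast+
    have "set (ys @ ?zs) \<subseteq> Span K (ys @ ?zs)"
      using carr' by (intro Span_base_incl[OF K]) simp
    then have "\<ominus> (ys ! i) \<in> Span K (ys @ ?zs)" "?zs ! i \<in> Span K (ys @ ?zs)"
      using mem carr' Span_subgroup_props(4)[OF K, of "ys @ ?zs" "ys ! i"] by auto
    then have "\<ominus> (ys ! i) \<oplus> ?zs ! i \<in> Span K (ys @ ?zs)"
      using carr' Span_subgroup_props(3)[OF K, of "ys @ ?zs"] by simp
    moreover have "\<ominus> (ys ! i) \<oplus> ?zs ! i = x"
      unfolding eq using c by algebra
    ultimately show "x \<in> Span K (ys @ ?zs)" by simp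
  qed
  then have "b \<in> Span K (ys @ ?zs)"
    using b mono_Span_subset[OF K, of "as @ bs" "ys @ ?zs"] carr' by auto
  then obtain u v where uv: "u \<in> Span K ys" "v \<in> Span K ?zs" "b = u \<oplus> v"
    unfolding Span_append_eq_set_add[OF K carr'] set_add_def' by blast
  obtain y where y: "y \<in> carrier R" "y \<notin> Span K ys" "y \<oplus> b \<notin> Span K ?zs"
    using additive_subgroups_not_cover_translate[OF Span_is_add_subgroup[OF K carr'(1)]
      Span_is_add_subgroup[OF K carr'(2)] proper' uv(1,2)] uv(3) by metis
  have ind: "independent K (y # ys)" "independent K ((y \<oplus> b) # ?zs)"
    using ys y carr by (auto intro!: li_Cons simp del: Span.simps)
  \<comment> \<open>The new entry was put in front; cutting \<open>ys\<close> at the length of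
    \<open>as\<close> moves it to the position of \<open>b\<close>, and independence does not depend
    on the order.\<close>
  obtain as' bs' where ys_eq: "ys = as' @ bs'" and lens: "length as' = length as" "length bs' = length bs"
    using ys(1) that[of "take (length as) ys" "drop (length as) ys"] by simp
  let ?xs = "as' @ y # bs'"
  have "independent K ?xs"
    by (rule independent_same_set[OF K _ _ ind(1)]) (simp_all add: ys_eq)
  moreover have "independent K (map2 (\<oplus>) ?xs ds)"
    by (rule independent_same_set[OF K _ _ ind(2)]) (simp_all add: ys_eq ds_eq lens)
  ultimately show ?thesis
    using lens ds_eq by (intro exI[of _ ?xs]) simp
qed

section \<open>Rank weight and covering radius\<close>

lemma finite_rank_weight_set:
  "finite {card I | I. I \<subseteq> {..<length x} \<and> ring.independent F K (nths x I)}"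
  by (rule finite_subset[of _ "card ` Pow {..<length x}"]) auto

lemma rank_weight_independent:
  assumes "ring.independent F K x"
  shows "length x \<le> rank_weight F K x"
proof -
  have "nths x {..<length x} = x"
    by (simp add: nths_all)
  then have "length x \<in> {card I | I. I \<subseteq> {..<length x} \<and> ring.independent F K (nths x I)}"
    using assms by (intro CollectI exI[of _ "{..<length x}"]) simp
  then show ?thesis
    unfolding rank_weight_def by (intro Max_ge finite_rank_weight_set)
qed

text \<open>Zero lies in every span, so no nonempty choice of positions is independent, and the
  maximum is attained at the empty set only.\<close>

lemma (in ring) rank_weight_zero:
  assumes "subfield K R" and "set x \<subseteq> {\<zero>}"
  shows "rank_weight R K x = 0"
proof -
  have "card I = 0" if I: "I \<subseteq> {..<length x}" and ind: "independent K (nths x I)" for I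
  proof (cases "nths x I")
    case Nil
    then have "card {i. i < length x \<and> i \<in> I} = 0"
      by (metis length_nths list.size(3))
    then show ?thesis
      using I by (metis (no_types, lifting) Collect_mem_eq Collect_cong lessThan_iff subset_iff)
  next
    case (Cons z zs)
    then have "z = \<zero>"
      using assms(2) set_nths_subset[of x I] by auto
    moreover have "\<zero> \<in> Span K zs"
      using Cons ind independent_in_carrier assms(1) Span_subgroup_props(2)
      by (metis independent_backwards(2))
    ultimately show ?thesis
      using Cons ind independent_backwards(1) by metis
  qed
  then have "{card I | I. I \<subseteq> {..<length x} \<and> independent K (nths x I)} \<subseteq> {0}"
    by auto
  moreover have "{card I | I. I \<subseteq> {..<length x} \<and> independent K (nths x I)} \<noteq> {}"
    using li_Nil nths_empty by (metis (mono_tags, lifting) Collect_empty_eq empty_subsetI)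
  ultimately have "{card I | I. I \<subseteq> {..<length x} \<and> independent K (nths x I)} = {0}"
    using subset_singletonD by fastforce
  then show ?thesis
    unfolding rank_weight_def by simp
qed

lemma finite_vectors:
  assumes "finite (carrier F)"
  shows "finite (vectors F n)"
  unfolding vectors_def using finite_lists_length_eq[OF assms] .

text \<open>Every vector is at distance zero from itself. This code makes the set behind
  \<open>rank_covering_number\<close> nonempty.\<close>

lemma (in ring) rank_covering_radius_vectors:
  assumes K: "subfield K R" and fin: "finite (carrier R)"
  shows "rank_covering_radius R K n (vectors R n) = 0"
proof -
  have "Min ((\<lambda>c. rank_dist R K x c) ` vectors R n) = 0" if x: "x \<in> vectors R n" for x
  proof -
    have "set (map2 (\<lambda>a b. a \<ominus> b) x x) \<subseteq> {\<zero>}"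
      using x unfolding vectors_def by (auto simp: zip_same minus_eq r_neg)
    then have "rank_dist R K x x = 0"
      unfolding rank_dist_def using rank_weight_zero[OF K] by blast
    then have "0 \<in> (\<lambda>c. rank_dist R K x c) ` vectors R n"
      using x by (metis imageI)
    then have "Min ((\<lambda>c. rank_dist R K x c) ` vectors R n) \<le> 0"
      using fin by (intro Min_le) (simp_all add: finite_vectors)
    then show ?thesis by simp
  qed
  then have "(\<lambda>x. Min ((\<lambda>c. rank_dist R K x c) ` vectors R n)) ` vectors R n = (\<lambda>x. 0) ` vectors R n"
    by (intro image_cong) auto
  moreover have "replicate n \<zero> \<in> vectors R n"
    unfolding vectors_def by auto
  then have "vectors R n \<noteq> {}"
    by blast
  ultimately show ?thesis
    unfolding rank_covering_radius_def by (simp add: image_constant_conv)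
qed

lemma rank_covering_radius_ge:
  assumes "finite (carrier F)" and "C \<subseteq> vectors F n" and "C \<noteq> {}" and "x \<in> vectors F n"
    and "\<And>c. c \<in> C \<Longrightarrow> r \<le> rank_dist F K x c"
  shows "r \<le> rank_covering_radius F K n C"
proof -
  have "r \<le> Min ((\<lambda>c. rank_dist F K x c) ` C)"
    using assms finite_subset[OF assms(2) finite_vectors[OF assms(1)]] by simp
  also have "\<dots> \<le> rank_covering_radius F K n C"
    unfolding rank_covering_radius_def using assms by (intro Max_ge) (auto simp: finite_vectors)
  finally show ?thesis .
qed

section \<open>Two codewords do not suffice\<close>

text \<open>With \<open>x = y + a\<close>, the differences to \<open>a\<close> and \<open>b\<close>
  are \<open>y\<close> and \<open>y + (a - b)\<close>, which can be made independent
  simultaneously.\<close>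

lemma (in field) exists_vector_far_from_two:
  assumes K: "subfield K R" and card: "card (carrier R) = card K ^ m" and fin: "finite (carrier R)"
    and n: "2 \<le> n" "n \<le> m" and a: "a \<in> vectors R n" and b: "b \<in> vectors R n"
  obtains x where "x \<in> vectors R n" and "n \<le> rank_dist R K x a" and "n \<le> rank_dist R K x b"
proof -
  have sub: "K \<subseteq> carrier R"
    using subringE(1)[OF subfieldE(1)[OF K]] .
  have finK: "finite K"
    using sub fin finite_subset by blast
  have "{\<zero>, \<one>} \<subseteq> K"
    using subringE(2,3)[OF subfieldE(1)[OF K]] by simp
  then have K2: "2 \<le> card K"
    using card_mono[OF finK, of "{\<zero>, \<one>}"] by simp
  have proper: "Span K Us \<noteq> carrier R" if "set Us \<subseteq> carrier R" "length Us < m" for Us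
  proof -
    have "card (Span K Us) \<le> card K ^ length Us"
      using card_Span_le[OF K that(1) finK] .
    also have "\<dots> < card K ^ m"
      using K2 that(2) by simp
    finally show ?thesis using card by auto
  qed
  \<comment> \<open>Since \<open>m\<close> is at least 2, the field has at least four elements,
    which leaves a \<open>w\<close> other than \<open>\<zero>\<close> and
    \<open>\<ominus> \<one>\<close>.\<close>
  have "card {\<zero>, \<ominus> \<one>} < (2::nat) ^ 2"
    by (simp add: card_insert_if)
  also have "\<dots> \<le> card K ^ 2"
    using K2 by (intro power_mono) auto
  also have "\<dots> \<le> card (carrier R)"
    unfolding card using K2 n by (intro power_increasing) auto
  finally have "\<not> carrier R \<subseteq> {\<zero>, \<ominus> \<one>}"
    using card_mono[of "{\<zero>, \<ominus> \<one>}" "carrier R"] by auto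
  then obtain w where w: "w \<in> carrier R" "w \<noteq> \<zero>" "w \<noteq> \<ominus> \<one>"
    by auto
  then have w1: "w \<oplus> \<one> \<noteq> \<zero>"
    using minus_equality[of w \<one>] by auto
  have la: "length a = n" "set a \<subseteq> carrier R" and lb: "length b = n" "set b \<subseteq> carrier R"
    using a b unfolding vectors_def by auto
  let ?d = "map2 (\<lambda>a b. a \<ominus> b) a b"
  have d: "set ?d \<subseteq> carrier R" "length ?d = n"
    using la lb by (simp_all, fastforce dest: set_zip_leftD set_zip_rightD)
  obtain ys where ys: "length ys = n" "independent K ys" "independent K (map2 (\<oplus>) ys ?d)"
    using exists_independent_pair_le[OF K _ d(1) _ w(1,2) w1] proper n d(2) by (metis (no_types))
  have ysc: "set ys \<subseteq> carrier R"
    using ys(2) independent_in_carrier by blast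
  define x where "x = map2 (\<oplus>) ys a"
  have nth: "ys ! i \<in> carrier R" "a ! i \<in> carrier R" "b ! i \<in> carrier R" if "i < n" for i
    using that ysc la lb ys(1) by (metis nth_mem subsetD)+
  have x: "x \<in> vectors R n"
    unfolding x_def vectors_def using la ys(1) ysc by (auto dest: set_zip_leftD set_zip_rightD)
  have cancel: "p \<oplus> q \<ominus> q = p" if "p \<in> carrier R" "q \<in> carrier R" for p q
    using that by algebra
  have assoc: "p \<oplus> q \<ominus> r = p \<oplus> (q \<ominus> r)"
    if "p \<in> carrier R" "q \<in> carrier R" "r \<in> carrier R" for p q r
    using that by algebra
  have "map2 (\<lambda>a b. a \<ominus> b) x a = ys"
    using nth cancel la ys(1) by (intro nth_equalityI) (auto simp: x_def)
  moreover have "map2 (\<lambda>a b. a \<ominus> b) x b = map2 (\<oplus>) ys ?d"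
    using nth assoc la lb ys(1) by (intro nth_equalityI) (auto simp: x_def)
  ultimately have "n \<le> rank_dist R K x a" "n \<le> rank_dist R K x b"
    unfolding rank_dist_def
    using rank_weight_independent[OF ys(2)] rank_weight_independent[OF ys(3)] ys(1) la lb by simp_all
  then show thesis
    using that x by blast
qed

theorem proposition6:
  fixes F :: "('a, 'b) ring_scheme" and K :: "'a set" and q m n \<rho> :: nat
  assumes "primepow q"
    and "field F" and "card (carrier F) = q ^ m"
    and "subfield K F" and "card K = q"
    and "0 < \<rho>" and "\<rho> < n" and "n \<le> m"
  shows "rank_covering_number F K n \<rho> \<ge> 3"
proof -
  interpret F: field F by fact
  \<comment> \<open>An infinite set has \<open>card\<close> zero, so a positive \<open>q ^ m\<close>
    forces the field to be finite.\<close>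
  have "q > 0"
    using \<open>primepow q\<close> primepow_gt_0_nat by blast
  then have fin: "finite (carrier F)"
    using assms(3) card_gt_0_iff[of "carrier F"] by simp
  let ?S = "{card C | C. C \<subseteq> vectors F n \<and> C \<noteq> {} \<and> rank_covering_radius F K n C \<le> \<rho>}"
  have "finite ?S"
    by (rule finite_subset[of _ "card ` Pow (vectors F n)"]) (auto simp: finite_vectors fin)
  moreover have "?S \<noteq> {}"
  proof -
    have "replicate n \<zero>\<^bsub>F\<^esub> \<in> vectors F n"
      unfolding vectors_def by auto
    then show ?thesis
      using F.rank_covering_radius_vectors[OF \<open>subfield K F\<close> fin, of n] by fastforce
  qed
  moreover have "3 \<le> card C"
    if C: "C \<subseteq> vectors F n" "C \<noteq> {}" "rank_covering_radius F K n C \<le> \<rho>" for C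
  proof (rule ccontr)
    assume "\<not> 3 \<le> card C"
    have "finite C"
      using C(1) finite_vectors[OF fin] finite_subset by blast
    then have "card C \<noteq> 0"
      using C(2) by simp
    with \<open>\<not> 3 \<le> card C\<close> have "card C = 1 \<or> card C = 2"
      by linarith
    \<comment> \<open>The case \<open>a = b\<close> covers codes with a single word.\<close>
    then obtain a b where ab: "C = {a, b}"
      by (metis card_1_singletonE card_2_iff insert_absorb2)
    \<comment> \<open>The bound \<open>2 \<le> n\<close> comes from \<open>0 < \<rho>\<close> and
      \<open>\<rho> < n\<close>.\<close>
    obtain x where "x \<in> vectors F n" "n \<le> rank_dist F K x a" "n \<le> rank_dist F K x b"
      using F.exists_vector_far_from_two[OF \<open>subfield K F\<close> _ fin, of m n a b] assms C(1) ab by auto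
    then have "n \<le> rank_covering_radius F K n C"
      using rank_covering_radius_ge[OF fin C(1,2)] ab by blast
    then show False
      using C(3) \<open>\<rho> < n\<close> by simp
  qed
  ultimately show ?thesis
    unfolding rank_covering_number_def by (subst Min_ge_iff) auto
qed

end
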